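(* Let $V$ be an $n$-dimensional vector space over a field $\mathbb{K}$ and let $\mathcal{A}=(V,\mu,\eta,\alpha)$ and $\mathcal{A}'=(V,\mu',\eta,\alpha)$ be two unital hom-associative algebras (with the same $\eta$ and $\alpha$), with $\alpha(\eta(1))=\eta(1)$. Let $\mathcal{K}_1(\mathcal{A})=(\tilde V,\mu_1,\eta_1,\Delta_1,\varepsilon_1,\alpha_1)$ and $\mathcal{K}_1(\mathcal{A}')=(\tilde V,\mu'_1,\eta_1,\Delta_1,\varepsilon_1,\alpha_1)$ be the associated unital hom-bialgebras given by the $\mathcal{K}_1$ construction described in the context. Then $\mathcal{B}_1=(\tilde V,\mu_1,\mu'_1,\eta_1,\Delta_1,\varepsilon_1,\alpha_1)$ is an $(n+1)$-dimensional unital $2$-hom-associative bialgebra over the vector space $\tilde V=\mathrm{span}(V,e_1)$, where $\eta_1(1)=e_1$.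
   Context: All spaces are over a field $\mathbb{K}$ and all structure maps are linear. A hom-associative algebra $(V,\mu,\alpha)$ is a vector space $V$ with a bilinear map $\mu:V\times V\to V$ and a linear map $\alpha:V\to V$ such that $\alpha\circ\mu=\mu\circ(\alpha\otimes\alpha)$ and $\mu\circ(\alpha\otimes\mu)=\mu\circ(\mu\otimes\alpha)$. It is unital, written $(V,\mu,\eta,\alpha)$, if there is $e\in V$ with $\mu(x,e)=\mu(e,x)=x$ for all $x\in V$; here $\eta:\mathbb{K}\to V$ is $\eta(c)=ce$. A hom-coassociative coalgebra $(V,\Delta,\alpha)$ has linear maps $\Delta:V\to V\otimes V$, $\alpha:V\to V$ with $(\alpha\otimes\alpha)\circ\Delta=\Delta\circ\alpha$ and $(\alpha\otimes\Delta)\circ\Delta=(\Delta\otimes\alpha)\circ\Delta$. It is counital, written $(V,\Delta,\varepsilon,\alpha)$, if $\varepsilon:V\to\mathbb{K}$ is linear and $(\varepsilon\otimes\alpha)\Delta(x)=(\alpha\otimes\varepsilon)\Delta(x)=\alpha^2(x)$ for all $x\in V$. A unital hom-bialgebra $(V,\mu,\eta,\Delta,\varepsilon,\alpha)$ is such that $(V,\mu,\eta,\alpha)$ is a unital hom-associative algebra, $(V,\Delta,\varepsilon,\alpha)$ is a counital hom-coassociative coalgebra, and for all $x,y\in V$: $\Delta(\mu(x\otimes y))=\Delta(x)\bullet\Delta(y)$, $(\alpha\otimes\alpha)\circ\Delta=\Delta\circ\alpha$, $\varepsilon(\mu(x\otimes y))=\varepsilon(x)\varepsilon(y)$, $\varepsilon\circ\alpha(x)=\varepsilon(x)$,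 where $(x\otimes y)\bullet(x'\otimes y')=\mu(x\otimes x')\otimes\mu(y\otimes y')$. A unital infinitesimal hom-bialgebra $(V,\mu,\eta,\Delta,\varepsilon,\alpha)$ is such that $(V,\mu,\eta,\alpha)$ is a unital hom-associative algebra, $(V,\Delta,\varepsilon,\alpha)$ is a counital hom-coassociative coalgebra, and $\Delta\circ\mu=(\mu\otimes\alpha)\circ(\alpha\otimes\Delta)+(\alpha\otimes\mu)\circ(\Delta\otimes\alpha)-\alpha^2\otimes\alpha$. A unital $2$-hom-associative bialgebra $(V,\mu_1,\mu_2,\eta,\Delta,\varepsilon,\alpha)$ is such that $(V,\mu_1,\eta,\Delta,\varepsilon,\alpha)$ is a unital hom-bialgebra and $(V,\mu_2,\eta,\Delta,\varepsilon,\alpha)$ is a unital infinitesimal hom-bialgebra. The construction $\mathcal{K}_1$: for a unital hom-associative algebra $\mathcal{A}=(V,\mu,\eta,\alpha)$ with unit $e_2=\eta(1)$, $\alpha(e_2)=e_2$, put $\tilde V=\mathrm{span}(V,e_1)=V\oplus\mathbb{K}e_1$ with $e_1$ a new vector, and $\mathcal{K}_1(\mathcal{A})=(\tilde V,\mu_1,\eta_1,\Delta_1,\varepsilon_1,\alpha_1)$, where $\mu_1(e_1\otimes x)=\mu_1(x\otimes e_1)=x$ for $x\in\tilde V$, $\mu_1(x\otimes y)=\mu(x\otimes y)$ for $x,y\in V$; $\eta_1(1)=e_1$; $\Delta_1(e_1)=e_1\otimes e_1$, $\Delta_1(x)=\alpha(x)\otimes e_1+e_1\otimes\alpha(x)-e_2\otimes\alpha(x)$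 for $x\in V$; $\varepsilon_1(e_1)=1$, $\varepsilon_1(x)=0$ for $x\in V$; $\alpha_1(e_1)=e_1$, $\alpha_1(e_2)=e_2$, $\alpha_1(x)=\alpha(x)$ for $x\in V$. For $\mathcal{A}'$ the product on $\tilde V$ obtained from $\mu'$ is denoted $\mu'_1$. *)

theory Defs
  imports "HOL-Analysis.Product_Vector" "HOL-Library.Poly_Mapping"
begin

(* Tensor powers of V by the usual construction: the free vector space on V x V
   (resp. V x V x V) modulo the subspace spanned by the multilinearity relations.
   The quotient is not a type, because it depends on the scalar multiplication; a tensor is
   given by a formal sum representing it, and equality in V (x) V, V (x) V (x) V is
   tensor2_eq, tensor3_eq. *)

definition fscale :: "'k::field \<Rightarrow> ('b \<Rightarrow>\<^sub>0 'k) \<Rightarrow> ('b \<Rightarrow>\<^sub>0 'k)" where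
  "fscale c = Poly_Mapping.map ((*) c)"

(* linear extension of a map defined on the basis of a free vector space *)
definition lin_ext ::
    "('k::field \<Rightarrow> 'w::ab_group_add \<Rightarrow> 'w) \<Rightarrow> ('b \<Rightarrow> 'w) \<Rightarrow> ('b \<Rightarrow>\<^sub>0 'k) \<Rightarrow> 'w" where
  "lin_ext s f t = (\<Sum>b\<in>Poly_Mapping.keys t. s (Poly_Mapping.lookup t b) (f b))"

abbreviation pure2 :: "'v \<Rightarrow> 'v \<Rightarrow> ('v \<times> 'v \<Rightarrow>\<^sub>0 'k::field)" where
  "pure2 x y \<equiv> Poly_Mapping.single (x, y) 1"

abbreviation pure3 :: "'v \<Rightarrow> 'v \<Rightarrow> 'v \<Rightarrow> ('v \<times> 'v \<times> 'v \<Rightarrow>\<^sub>0 'k::field)" where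
  "pure3 x y z \<equiv> Poly_Mapping.single (x, y, z) 1"

definition tensor2_rel ::
    "('k::field \<Rightarrow> 'v::ab_group_add \<Rightarrow> 'v) \<Rightarrow> ('v \<times> 'v \<Rightarrow>\<^sub>0 'k) set" where
  "tensor2_rel s = module.span fscale
     ({pure2 (x + x') y - pure2 x y - pure2 x' y | x x' y. True} \<union>
      {pure2 x (y + y') - pure2 x y - pure2 x y' | x y y'. True} \<union>
      {pure2 (s c x) y - fscale c (pure2 x y) | c x y. True} \<union>
      {pure2 x (s c y) - fscale c (pure2 x y) | c x y. True})"

definition tensor3_rel ::
    "('k::field \<Rightarrow> 'v::ab_group_add \<Rightarrow> 'v) \<Rightarrow> ('v \<times> 'v \<times> 'v \<Rightarrow>\<^sub>0 'k) set" where
  "tensor3_rel s = module.span fscale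
     ({pure3 (x + x') y z - pure3 x y z - pure3 x' y z | x x' y z. True} \<union>
      {pure3 x (y + y') z - pure3 x y z - pure3 x y' z | x y y' z. True} \<union>
      {pure3 x y (z + z') - pure3 x y z - pure3 x y z' | x y z z'. True} \<union>
      {pure3 (s c x) y z - fscale c (pure3 x y z) | c x y z. True} \<union>
      {pure3 x (s c y) z - fscale c (pure3 x y z) | c x y z. True} \<union>
      {pure3 x y (s c z) - fscale c (pure3 x y z) | c x y z. True})"

definition tensor2_eq ::
    "('k::field \<Rightarrow> 'v::ab_group_add \<Rightarrow> 'v) \<Rightarrow> ('v \<times> 'v \<Rightarrow>\<^sub>0 'k) \<Rightarrow> ('v \<times> 'v \<Rightarrow>\<^sub>0 'k) \<Rightarrow> bool" where
  "tensor2_eq s t u \<longleftrightarrow> t - u \<in> tensor2_rel s"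

definition tensor3_eq ::
    "('k::field \<Rightarrow> 'v::ab_group_add \<Rightarrow> 'v) \<Rightarrow>
      ('v \<times> 'v \<times> 'v \<Rightarrow>\<^sub>0 'k) \<Rightarrow> ('v \<times> 'v \<times> 'v \<Rightarrow>\<^sub>0 'k) \<Rightarrow> bool" where
  "tensor3_eq s t u \<longleftrightarrow> t - u \<in> tensor3_rel s"

(* f (x) g on V (x) V *)
definition tensor_map ::
    "('v \<Rightarrow> 'v) \<Rightarrow> ('v \<Rightarrow> 'v) \<Rightarrow> ('v \<times> 'v \<Rightarrow>\<^sub>0 'k::field) \<Rightarrow> ('v \<times> 'v \<Rightarrow>\<^sub>0 'k)" where
  "tensor_map f g = lin_ext fscale (\<lambda>(x, y). pure2 (f x) (g y))"

(* f (x) D : V (x) V -> V (x) V (x) V for D : V -> V (x) V *)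
definition map_tensor_comult ::
    "('v \<Rightarrow> 'v) \<Rightarrow> ('v \<Rightarrow> ('v \<times> 'v \<Rightarrow>\<^sub>0 'k::field)) \<Rightarrow>
      ('v \<times> 'v \<Rightarrow>\<^sub>0 'k) \<Rightarrow> ('v \<times> 'v \<times> 'v \<Rightarrow>\<^sub>0 'k)" where
  "map_tensor_comult f D =
     lin_ext fscale (\<lambda>(x, y). lin_ext fscale (\<lambda>(u, v). pure3 (f x) u v) (D y))"

(* D (x) f : V (x) V -> V (x) V (x) V *)
definition comult_tensor_map ::
    "('v \<Rightarrow> ('v \<times> 'v \<Rightarrow>\<^sub>0 'k::field)) \<Rightarrow> ('v \<Rightarrow> 'v) \<Rightarrow>
      ('v \<times> 'v \<Rightarrow>\<^sub>0 'k) \<Rightarrow> ('v \<times> 'v \<times> 'v \<Rightarrow>\<^sub>0 'k)" where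
  "comult_tensor_map D f =
     lin_ext fscale (\<lambda>(x, y). lin_ext fscale (\<lambda>(u, v). pure3 u v (f y)) (D x))"

(* m (x) f : V (x) V (x) V -> V (x) V for bilinear m *)
definition mult_tensor_map ::
    "('v \<Rightarrow> 'v \<Rightarrow> 'v) \<Rightarrow> ('v \<Rightarrow> 'v) \<Rightarrow>
      ('v \<times> 'v \<times> 'v \<Rightarrow>\<^sub>0 'k::field) \<Rightarrow> ('v \<times> 'v \<Rightarrow>\<^sub>0 'k)" where
  "mult_tensor_map m f = lin_ext fscale (\<lambda>(x, y, z). pure2 (m x y) (f z))"

(* f (x) m : V (x) V (x) V -> V (x) V *)
definition map_tensor_mult ::
    "('v \<Rightarrow> 'v) \<Rightarrow> ('v \<Rightarrow> 'v \<Rightarrow> 'v) \<Rightarrow>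
      ('v \<times> 'v \<times> 'v \<Rightarrow>\<^sub>0 'k::field) \<Rightarrow> ('v \<times> 'v \<Rightarrow>\<^sub>0 'k)" where
  "map_tensor_mult f m = lin_ext fscale (\<lambda>(x, y, z). pure2 (f x) (m y z))"

(* p (x) f and f (x) p for a linear form p, followed by the identification of
   K (x) V and V (x) K with V *)
definition form_tensor_map ::
    "('k::field \<Rightarrow> 'v::ab_group_add \<Rightarrow> 'v) \<Rightarrow> ('v \<Rightarrow> 'k) \<Rightarrow> ('v \<Rightarrow> 'v) \<Rightarrow>
      ('v \<times> 'v \<Rightarrow>\<^sub>0 'k) \<Rightarrow> 'v" where
  "form_tensor_map s p f = lin_ext s (\<lambda>(x, y). s (p x) (f y))"

definition map_tensor_form ::
    "('k::field \<Rightarrow> 'v::ab_group_add \<Rightarrow> 'v) \<Rightarrow> ('v \<Rightarrow> 'v) \<Rightarrow> ('v \<Rightarrow> 'k) \<Rightarrow>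
      ('v \<times> 'v \<Rightarrow>\<^sub>0 'k) \<Rightarrow> 'v" where
  "map_tensor_form s f p = lin_ext s (\<lambda>(x, y). s (p y) (f x))"

(* the product on V (x) V written with a bullet:
   (x (x) y) * (x' (x) y') = m x x' (x) m y y' *)
definition tensor_mult ::
    "('v \<Rightarrow> 'v \<Rightarrow> 'v) \<Rightarrow>
      ('v \<times> 'v \<Rightarrow>\<^sub>0 'k::field) \<Rightarrow> ('v \<times> 'v \<Rightarrow>\<^sub>0 'k) \<Rightarrow> ('v \<times> 'v \<Rightarrow>\<^sub>0 'k)" where
  "tensor_mult m t u =
     lin_ext fscale (\<lambda>(x, y). lin_ext fscale (\<lambda>(x', y'). pure2 (m x x') (m y y')) u) t"


locale hom_associative_algebra = vector_space scale
  for scale :: "'k::field \<Rightarrow> 'v::ab_group_add \<Rightarrow> 'v" (infixr \<open>*s\<close> 75) +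
  fixes \<mu> :: "'v \<Rightarrow> 'v \<Rightarrow> 'v" and \<alpha> :: "'v \<Rightarrow> 'v"
  assumes mult_linear_left: "Vector_Spaces.linear scale scale (\<lambda>x. \<mu> x y)"
    and mult_linear_right: "Vector_Spaces.linear scale scale (\<lambda>y. \<mu> x y)"
    and twist_linear: "Vector_Spaces.linear scale scale \<alpha>"
    and twist_mult: "\<alpha> (\<mu> x y) = \<mu> (\<alpha> x) (\<alpha> y)"
    and hom_assoc: "\<mu> (\<alpha> x) (\<mu> y z) = \<mu> (\<mu> x y) (\<alpha> z)"

locale unital_hom_associative_algebra = hom_associative_algebra scale \<mu> \<alpha>
  for scale :: "'k::field \<Rightarrow> 'v::ab_group_add \<Rightarrow> 'v" (infixr \<open>*s\<close> 75)
    and \<mu> :: "'v \<Rightarrow> 'v \<Rightarrow> 'v" and \<eta> :: "'k \<Rightarrow> 'v" and \<alpha> :: "'v \<Rightarrow> 'v" +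
  assumes unital: "\<exists>e. (\<forall>x. \<mu> x e = x \<and> \<mu> e x = x) \<and> (\<forall>c. \<eta> c = c *s e)"

locale hom_coassociative_coalgebra = vector_space scale
  for scale :: "'k::field \<Rightarrow> 'v::ab_group_add \<Rightarrow> 'v" (infixr \<open>*s\<close> 75) +
  fixes \<Delta> :: "'v \<Rightarrow> ('v \<times> 'v \<Rightarrow>\<^sub>0 'k)" and \<alpha> :: "'v \<Rightarrow> 'v"
  assumes comult_add: "tensor2_eq scale (\<Delta> (x + y)) (\<Delta> x + \<Delta> y)"
    and comult_scale: "tensor2_eq scale (\<Delta> (c *s x)) (fscale c (\<Delta> x))"
    and cotwist_linear: "Vector_Spaces.linear scale scale \<alpha>"
    and cotwist_comult: "tensor2_eq scale (tensor_map \<alpha> \<alpha> (\<Delta> x)) (\<Delta> (\<alpha> x))"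
    and hom_coassoc:
      "tensor3_eq scale (map_tensor_comult \<alpha> \<Delta> (\<Delta> x)) (comult_tensor_map \<Delta> \<alpha> (\<Delta> x))"

locale counital_hom_coassociative_coalgebra = hom_coassociative_coalgebra scale \<Delta> \<alpha>
  for scale :: "'k::field \<Rightarrow> 'v::ab_group_add \<Rightarrow> 'v" (infixr \<open>*s\<close> 75)
    and \<Delta> :: "'v \<Rightarrow> ('v \<times> 'v \<Rightarrow>\<^sub>0 'k)" and \<epsilon> :: "'v \<Rightarrow> 'k" and \<alpha> :: "'v \<Rightarrow> 'v" +
  assumes counit_linear: "Vector_Spaces.linear scale (*) \<epsilon>"
    and counit_left: "form_tensor_map scale \<epsilon> \<alpha> (\<Delta> x) = \<alpha> (\<alpha> x)"
    and counit_right: "map_tensor_form scale \<alpha> \<epsilon> (\<Delta> x) = \<alpha> (\<alpha> x)"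

(* The compatibility of \<Delta> with \<alpha> is part of the coalgebra structure. *)
locale unital_hom_bialgebra =
  unital_hom_associative_algebra scale \<mu> \<eta> \<alpha> +
  counital_hom_coassociative_coalgebra scale \<Delta> \<epsilon> \<alpha>
  for scale :: "'k::field \<Rightarrow> 'v::ab_group_add \<Rightarrow> 'v" (infixr \<open>*s\<close> 75)
    and \<mu> :: "'v \<Rightarrow> 'v \<Rightarrow> 'v" and \<eta> :: "'k \<Rightarrow> 'v"
    and \<Delta> :: "'v \<Rightarrow> ('v \<times> 'v \<Rightarrow>\<^sub>0 'k)" and \<epsilon> :: "'v \<Rightarrow> 'k" and \<alpha> :: "'v \<Rightarrow> 'v" +
  assumes comult_mult: "tensor2_eq scale (\<Delta> (\<mu> x y)) (tensor_mult \<mu> (\<Delta> x) (\<Delta> y))"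
    and counit_mult: "\<epsilon> (\<mu> x y) = \<epsilon> x * \<epsilon> y"
    and counit_twist: "\<epsilon> (\<alpha> x) = \<epsilon> x"

(* The identity of maps on V (x) V is stated on the generators x (x) y. *)
locale unital_infinitesimal_hom_bialgebra =
  unital_hom_associative_algebra scale \<mu> \<eta> \<alpha> +
  counital_hom_coassociative_coalgebra scale \<Delta> \<epsilon> \<alpha>
  for scale :: "'k::field \<Rightarrow> 'v::ab_group_add \<Rightarrow> 'v" (infixr \<open>*s\<close> 75)
    and \<mu> :: "'v \<Rightarrow> 'v \<Rightarrow> 'v" and \<eta> :: "'k \<Rightarrow> 'v"
    and \<Delta> :: "'v \<Rightarrow> ('v \<times> 'v \<Rightarrow>\<^sub>0 'k)" and \<epsilon> :: "'v \<Rightarrow> 'k" and \<alpha> :: "'v \<Rightarrow> 'v" +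
  assumes infinitesimal: "tensor2_eq scale (\<Delta> (\<mu> x y))
      (mult_tensor_map \<mu> \<alpha> (map_tensor_comult \<alpha> \<Delta> (pure2 x y)) +
       map_tensor_mult \<alpha> \<mu> (comult_tensor_map \<Delta> \<alpha> (pure2 x y)) -
       tensor_map (\<alpha> \<circ> \<alpha>) \<alpha> (pure2 x y))"

locale unital_2_hom_associative_bialgebra =
  first: unital_hom_bialgebra scale \<mu>1 \<eta> \<Delta> \<epsilon> \<alpha> +
  second: unital_infinitesimal_hom_bialgebra scale \<mu>2 \<eta> \<Delta> \<epsilon> \<alpha>
  for scale :: "'k::field \<Rightarrow> 'v::ab_group_add \<Rightarrow> 'v" (infixr \<open>*s\<close> 75)
    and \<mu>1 :: "'v \<Rightarrow> 'v \<Rightarrow> 'v" and \<mu>2 :: "'v \<Rightarrow> 'v \<Rightarrow> 'v" and \<eta> :: "'k \<Rightarrow> 'v"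
    and \<Delta> :: "'v \<Rightarrow> ('v \<times> 'v \<Rightarrow>\<^sub>0 'k)" and \<epsilon> :: "'v \<Rightarrow> 'k" and \<alpha> :: "'v \<Rightarrow> 'v"

(* The dimension operator of the library is not used: it is 0 on infinite-dimensional spaces. *)
definition has_dimension :: "('k::field \<Rightarrow> 'v::ab_group_add \<Rightarrow> 'v) \<Rightarrow> nat \<Rightarrow> bool" where
  "has_dimension s n \<longleftrightarrow> (\<exists>B. finite_dimensional_vector_space s B \<and> card B = n)"


(* The construction K_1. The space V + K e1 is the product type 'v * 'k, where (x, a) stands
   for x + a e1; V is embedded by x |-> (x, 0), and the maps given on V and on e1 are
   extended (bi)linearly. *)

abbreviation K1_scale ::
    "('k::field \<Rightarrow> 'v::ab_group_add \<Rightarrow> 'v) \<Rightarrow> 'k \<Rightarrow> 'v \<times> 'k \<Rightarrow> 'v \<times> 'k" where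
  "K1_scale s \<equiv> module_prod.scale s (*)"

definition K1_e1 :: "'v::ab_group_add \<times> 'k::field" where
  "K1_e1 = (0, 1)"

definition K1_mult ::
    "('k::field \<Rightarrow> 'v::ab_group_add \<Rightarrow> 'v) \<Rightarrow> ('v \<Rightarrow> 'v \<Rightarrow> 'v) \<Rightarrow>
      'v \<times> 'k \<Rightarrow> 'v \<times> 'k \<Rightarrow> 'v \<times> 'k" where
  "K1_mult s \<mu> = (\<lambda>(x, a) (y, b). (\<mu> x y + s b x + s a y, a * b))"

definition K1_unit ::
    "('k::field \<Rightarrow> 'v::ab_group_add \<Rightarrow> 'v) \<Rightarrow> 'k \<Rightarrow> 'v \<times> 'k" where
  "K1_unit s c = K1_scale s c K1_e1"

definition K1_comult ::
    "('k::field \<Rightarrow> 'v::ab_group_add) \<Rightarrow> ('v \<Rightarrow> 'v) \<Rightarrow>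
      'v \<times> 'k \<Rightarrow> (('v \<times> 'k) \<times> ('v \<times> 'k) \<Rightarrow>\<^sub>0 'k)" where
  "K1_comult \<eta> \<alpha> = (\<lambda>(x, a).
     fscale a (pure2 K1_e1 K1_e1) +
     (pure2 (\<alpha> x, 0) K1_e1 + pure2 K1_e1 (\<alpha> x, 0) - pure2 (\<eta> 1, 0) (\<alpha> x, 0)))"

definition K1_counit :: "'v \<times> 'k::field \<Rightarrow> 'k" where
  "K1_counit = (\<lambda>(x, a). a)"

definition K1_twist :: "('v \<Rightarrow> 'v) \<Rightarrow> 'v \<times> 'k::field \<Rightarrow> 'v \<times> 'k" where
  "K1_twist \<alpha> = (\<lambda>(x, a). (\<alpha> x, a))"

end

theory Submission
  imports Defs
begin

text \<open>
  Putting \<open>y = z = e\<^sub>2\<close> in \<open>\<mu> (\<alpha> x) (\<mu> y z) = \<mu> (\<mu> x y) (\<alpha> z)\<close> gives \<open>\<alpha> x = x\<close> as soon as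
  \<open>\<alpha> e\<^sub>2 = e\<^sub>2\<close> (\<open>twist_eq_id\<close>). So \<open>\<mu>\<close> and \<open>\<mu>'\<close> are associative products with the common
  unit \<open>e\<^sub>2\<close>, and \<open>\<mu>\<^sub>1\<close>, \<open>\<mu>'\<^sub>1\<close> arise from them by adjoining a new unit \<open>e\<^sub>1\<close>.

  The coproduct, counit and twist on \<open>V \<oplus> K e\<^sub>1\<close> refer to a product only through its unit
  \<open>e\<^sub>2\<close>, so both products live over one and the same coalgebra (\<open>counital_coalgebra_K1\<close>). It
  remains to see that each product obtained in this way satisfies both compatibility conditions
  with \<open>\<Delta>\<^sub>1\<close>. On \<open>V\<close> the coproduct is \<open>x \<otimes> e\<^sub>1 + (e\<^sub>1 - e\<^sub>2) \<otimes> x\<close>, and because \<open>e\<^sub>1\<close> is the unit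
  of the whole space and \<open>e\<^sub>2\<close> that of \<open>V\<close>, the element \<open>e\<^sub>1 - e\<^sub>2\<close> is an idempotent with
  \<open>(e\<^sub>1 - e\<^sub>2) V = V (e\<^sub>1 - e\<^sub>2) = 0\<close>. This makes the mixed terms vanish in
  \<open>\<Delta>\<^sub>1 x \<bullet> \<Delta>\<^sub>1 y\<close> (\<open>K1_comult_mult\<close>) and leaves a single \<open>x \<otimes> y\<close> in the infinitesimal rule,
  which its last term removes (\<open>K1_infinitesimal\<close>).

  Equality of tensors means membership of the difference in a span of multilinearity relations.
  Instead of exhibiting linear combinations of relations, each identity is checked after
  evaluation at an arbitrary bilinear or trilinear form: over a field such forms separate tensors
  (\<open>tensor2_eqI\<close>, \<open>tensor3_eqI\<close>), and what remains are identities between scalars.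
\<close>

section \<open>Linear extension from a free vector space\<close>

lemma lookup_fscale [simp]: "Poly_Mapping.lookup (fscale c t) b = c * Poly_Mapping.lookup t b"
  by (simp add: fscale_def Poly_Mapping.map.rep_eq when_def)

lemma vector_space_fscale: "vector_space (fscale :: 'k::field \<Rightarrow> ('b \<Rightarrow>\<^sub>0 'k) \<Rightarrow> _)"
  by unfold_locales (auto intro!: poly_mapping_eqI simp: lookup_add algebra_simps)

lemma vector_space_field: "vector_space ((*) :: 'k::field \<Rightarrow> 'k \<Rightarrow> 'k)"
  by unfold_locales (auto simp: algebra_simps)

context vector_space
begin

lemma lin_ext_eq_sum_superset:
  assumes "finite A" "Poly_Mapping.keys t \<subseteq> A"
  shows "lin_ext scale f t = (\<Sum>b\<in>A. scale (Poly_Mapping.lookup t b) (f b))"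
  unfolding lin_ext_def using assms
  by (intro sum.mono_neutral_left) (auto simp: in_keys_iff)

lemma lin_ext_zero: "lin_ext scale f 0 = 0"
  by (simp add: lin_ext_def)

lemma lin_ext_single: "lin_ext scale f (Poly_Mapping.single b c) = scale c (f b)"
  by (subst lin_ext_eq_sum_superset[of "{b}"]) (auto simp: lookup_single)

lemma lin_ext_add: "lin_ext scale f (t + u) = lin_ext scale f t + lin_ext scale f u"
proof -
  let ?A = "Poly_Mapping.keys t \<union> Poly_Mapping.keys u"
  have "lin_ext scale f v = (\<Sum>b\<in>?A. scale (Poly_Mapping.lookup v b) (f b))"
    if "v \<in> {t, u, t + u}" for v
    using that Poly_Mapping.keys_add[of t u] by (intro lin_ext_eq_sum_superset) auto
  then show ?thesis
    by (simp add: lookup_add scale_left_distrib sum.distrib)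
qed

lemma lin_ext_scale: "lin_ext scale f (fscale c t) = scale c (lin_ext scale f t)"
proof -
  have "Poly_Mapping.keys (fscale c t) \<subseteq> Poly_Mapping.keys t"
    by (auto simp: in_keys_iff)
  then have "lin_ext scale f (fscale c t)
      = (\<Sum>b\<in>Poly_Mapping.keys t. scale (Poly_Mapping.lookup (fscale c t) b) (f b))"
    by (intro lin_ext_eq_sum_superset) simp_all
  then show ?thesis
    by (simp add: lin_ext_def scale_sum_right)
qed

lemma lin_ext_diff: "lin_ext scale f (t - u) = lin_ext scale f t - lin_ext scale f u"
  using lin_ext_add[of f "t - u" u] by simp

lemmas lin_ext_simps = lin_ext_zero lin_ext_single lin_ext_add lin_ext_diff lin_ext_scale

lemma linear_eq_lin_ext:
  assumes "Vector_Spaces.linear fscale scale f"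
  shows "f t = lin_ext scale (\<lambda>b. f (Poly_Mapping.single b 1)) t"
proof -
  interpret f: Vector_Spaces.linear fscale scale f by fact
  show ?thesis
  proof (induction t rule: update_induct)
    case const
    then show ?case by (simp add: lin_ext_simps f.zero)
  next
    case (update t a b)
    have "Poly_Mapping.update a b t = t + fscale b (Poly_Mapping.single a 1)"
      using update
      by (intro poly_mapping_eqI) (auto simp: lookup_update lookup_add lookup_single in_keys_iff when_def)
    with update show ?case
      by (simp add: lin_ext_simps f.add f.scale)
  qed
qed

end

section \<open>Multilinear forms separate tensors\<close>

text \<open>
  A vector outside a subspace extends a basis of the subspace to a larger independent set, on
  which a functional can be prescribed: zero on the subspace and one at the vector.
\<close>
lemma (in vector_space) mem_span_if_functionals_vanish:
  assumes "\<And>f. Vector_Spaces.linear scale (*) f \<Longrightarrow> \<forall>r\<in>R. f r = 0 \<Longrightarrow> f w = 0"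
  shows "w \<in> span R"
proof (rule ccontr)
  assume w: "w \<notin> span R"
  interpret field: vector_space "(*) :: 'a \<Rightarrow> 'a \<Rightarrow> 'a" by (rule vector_space_field)
  interpret forms: vector_space_pair scale "(*) :: 'a \<Rightarrow> 'a \<Rightarrow> 'a" ..
  obtain B where B: "B \<subseteq> R" "independent B" "R \<subseteq> span B"
    using maximal_independent_subset by blast
  have "w \<notin> span B"
    using w span_mono[OF B(1)] by blast
  then have "independent (insert w B)"
    using B(2) by (rule independent_insertI)
  then obtain f where f: "Vector_Spaces.linear scale (*) f"
      and f_eq: "\<forall>x\<in>insert w B. f x = (if x = w then 1 else 0)"
    using forms.linear_independent_extend[of "insert w B" "\<lambda>x. if x = w then 1 else 0"] by blast
  have "f b = 0" if "b \<in> B" for b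
    using f_eq that \<open>w \<notin> span B\<close> span_base by fastforce
  then have "f r = 0" if "r \<in> R" for r
    using forms.linear_eq_0_on_span[OF f] B(3) that by blast
  then have "f w = 0"
    using assms f by blast
  with f_eq show False by simp
qed

text \<open>
  Forms take pairs and triples, not curried arguments, so that they are maps on the basis of the
  free vector space and can be extended by \<^const>\<open>lin_ext\<close>.
\<close>
definition bilinear_form ::
    "('k::field \<Rightarrow> 'v::ab_group_add \<Rightarrow> 'v) \<Rightarrow> ('v \<times> 'v \<Rightarrow> 'k) \<Rightarrow> bool" where
  "bilinear_form s \<beta> \<longleftrightarrow>
     (\<forall>x x' y. \<beta> (x + x', y) = \<beta> (x, y) + \<beta> (x', y)) \<and>
     (\<forall>x y y'. \<beta> (x, y + y') = \<beta> (x, y) + \<beta> (x, y')) \<and>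
     (\<forall>c x y. \<beta> (s c x, y) = c * \<beta> (x, y)) \<and>
     (\<forall>c x y. \<beta> (x, s c y) = c * \<beta> (x, y))"

definition trilinear_form ::
    "('k::field \<Rightarrow> 'v::ab_group_add \<Rightarrow> 'v) \<Rightarrow> ('v \<times> 'v \<times> 'v \<Rightarrow> 'k) \<Rightarrow> bool" where
  "trilinear_form s \<gamma> \<longleftrightarrow>
     (\<forall>z. bilinear_form s (\<lambda>(x, y). \<gamma> (x, y, z))) \<and>
     (\<forall>x y z z'. \<gamma> (x, y, z + z') = \<gamma> (x, y, z) + \<gamma> (x, y, z')) \<and>
     (\<forall>c x y z. \<gamma> (x, y, s c z) = c * \<gamma> (x, y, z))"

text \<open>
  A functional on the free vector space on \<open>V \<times> V\<close> that kills the defining relations of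
  \<open>V \<otimes> V\<close> is the linear extension of a bilinear form, so the functionals that detect membership
  in the span of the relations all come from bilinear forms.
\<close>
lemma tensor2_eqI:
  assumes "\<And>\<beta>. bilinear_form s \<beta> \<Longrightarrow> lin_ext (*) \<beta> t = lin_ext (*) \<beta> u"
  shows "tensor2_eq (s :: 'k::field \<Rightarrow> 'v::ab_group_add \<Rightarrow> 'v) t u"
  unfolding tensor2_eq_def tensor2_rel_def
proof (rule vector_space.mem_span_if_functionals_vanish[OF vector_space_fscale])
  fix f :: "('v \<times> 'v \<Rightarrow>\<^sub>0 'k) \<Rightarrow> 'k"
  assume f: "Vector_Spaces.linear fscale (*) f"
    and vanish: "\<forall>r\<in>{pure2 (x + x') y - pure2 x y - pure2 x' y | x x' y. True} \<union>
      {pure2 x (y + y') - pure2 x y - pure2 x y' | x y y'. True} \<union>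
      {pure2 (s c x) y - fscale c (pure2 x y) | c x y. True} \<union>
      {pure2 x (s c y) - fscale c (pure2 x y) | c x y. True}. f r = 0"
  have zero:
      "f (pure2 (x + x') y - pure2 x y - pure2 x' y) = 0"
      "f (pure2 x (y + y') - pure2 x y - pure2 x y') = 0"
      "f (pure2 (s c x) y - fscale c (pure2 x y)) = 0"
      "f (pure2 x (s c y) - fscale c (pure2 x y)) = 0" for x x' y y' c
    by (rule bspec[OF vanish], fastforce)+
  interpret f: Vector_Spaces.linear fscale "(*)" f by fact
  have "bilinear_form s (\<lambda>b. f (Poly_Mapping.single b 1))"
    using zero by (simp add: bilinear_form_def f.add f.diff f.scale algebra_simps)
  from assms[OF this] show "f (t - u) = 0"
    by (simp add: f.diff vector_space.linear_eq_lin_ext[OF vector_space_field f, symmetric])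
qed

lemma tensor3_eqI:
  assumes "\<And>\<gamma>. trilinear_form s \<gamma> \<Longrightarrow> lin_ext (*) \<gamma> t = lin_ext (*) \<gamma> u"
  shows "tensor3_eq (s :: 'k::field \<Rightarrow> 'v::ab_group_add \<Rightarrow> 'v) t u"
  unfolding tensor3_eq_def tensor3_rel_def
proof (rule vector_space.mem_span_if_functionals_vanish[OF vector_space_fscale])
  fix f :: "('v \<times> 'v \<times> 'v \<Rightarrow>\<^sub>0 'k) \<Rightarrow> 'k"
  assume f: "Vector_Spaces.linear fscale (*) f"
    and vanish: "\<forall>r\<in>{pure3 (x + x') y z - pure3 x y z - pure3 x' y z | x x' y z. True} \<union>
      {pure3 x (y + y') z - pure3 x y z - pure3 x y' z | x y y' z. True} \<union>
      {pure3 x y (z + z') - pure3 x y z - pure3 x y z' | x y z z'. True} \<union>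
      {pure3 (s c x) y z - fscale c (pure3 x y z) | c x y z. True} \<union>
      {pure3 x (s c y) z - fscale c (pure3 x y z) | c x y z. True} \<union>
      {pure3 x y (s c z) - fscale c (pure3 x y z) | c x y z. True}. f r = 0"
  have zero:
      "f (pure3 (x + x') y z - pure3 x y z - pure3 x' y z) = 0"
      "f (pure3 x (y + y') z - pure3 x y z - pure3 x y' z) = 0"
      "f (pure3 x y (z + z') - pure3 x y z - pure3 x y z') = 0"
      "f (pure3 (s c x) y z - fscale c (pure3 x y z)) = 0"
      "f (pure3 x (s c y) z - fscale c (pure3 x y z)) = 0"
      "f (pure3 x y (s c z) - fscale c (pure3 x y z)) = 0" for x x' y y' z z' c
    by (rule bspec[OF vanish], fastforce)+
  interpret f: Vector_Spaces.linear fscale "(*)" f by fact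
  have "trilinear_form s (\<lambda>b. f (Poly_Mapping.single b 1))"
    using zero
    by (simp add: trilinear_form_def bilinear_form_def f.add f.diff f.scale algebra_simps)
  from assms[OF this] show "f (t - u) = 0"
    by (simp add: f.diff vector_space.linear_eq_lin_ext[OF vector_space_field f, symmetric])
qed

section \<open>The space \<open>V \<oplus> K e\<^sub>1\<close>\<close>

lemma vector_space_prod_field:
  assumes "vector_space s"
  shows "vector_space_prod s ((*) :: 'k::field \<Rightarrow> 'k \<Rightarrow> 'k)"
proof -
  interpret vector_space s by fact
  interpret field: vector_space "(*) :: 'k \<Rightarrow> 'k \<Rightarrow> 'k" by (rule vector_space_field)
  show ?thesis ..
qed

lemma K1_scale_Pair:
  assumes "vector_space s"
  shows "K1_scale s c (x, a) = (s c x, c * a)"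
proof -
  interpret vector_space_prod s "(*)" using assms by (rule vector_space_prod_field)
  show ?thesis by (rule scale_prod)
qed

lemma vector_space_K1_scale:
  assumes "vector_space s"
  shows "vector_space (K1_scale s)"
proof -
  interpret vector_space_prod s "(*)" using assms by (rule vector_space_prod_field)
  show ?thesis by (rule p.vector_space_axioms)
qed

lemma has_dimension_K1_scale:
  assumes "has_dimension s n"
  shows "has_dimension (K1_scale s) (n + 1)"
proof -
  obtain B where B: "finite_dimensional_vector_space s B" and n: "card B = n"
    using assms by (auto simp: has_dimension_def)
  interpret V: finite_dimensional_vector_space s B by fact
  interpret field: vector_space "(*) :: 'a \<Rightarrow> 'a \<Rightarrow> 'a" by (rule vector_space_field)
  interpret field: finite_dimensional_vector_space "(*) :: 'a \<Rightarrow> 'a \<Rightarrow> 'a" "{1}"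
  proof
    have "a \<in> field.span {1}" for a :: 'a
      using field.span_scale[OF field.span_base, of 1 "{1}" a] by simp
    then show "field.span {1} = (UNIV :: 'a set)" by blast
  qed simp_all
  interpret P: finite_dimensional_vector_space_prod s "(*)" B "{1}" ..
  have "(B \<times> {0}) \<inter> ({0} \<times> {1 :: 'a}) = {}" by auto
  then have "card P.Basis_pair = n + 1"
    unfolding P.Basis_pair_def
    by (subst card_Un_disjoint) (auto simp: V.finite_Basis card_cartesian_product n)
  then show ?thesis
    using P.p.finite_dimensional_vector_space_axioms by (auto simp: has_dimension_def)
qed

lemma linear_K1_twist:
  assumes "Vector_Spaces.linear s s \<alpha>"
  shows "Vector_Spaces.linear (K1_scale s) (K1_scale s) (K1_twist \<alpha>)"
proof -
  interpret \<alpha>: Vector_Spaces.linear s s \<alpha> by fact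
  note V = \<alpha>.vs1.vector_space_axioms
  show ?thesis
    using vector_space_K1_scale[OF V]
    by (auto simp: Vector_Spaces.linear_iff K1_twist_def K1_scale_Pair[OF V] \<alpha>.add \<alpha>.scale)
qed

lemma linear_K1_counit:
  assumes "vector_space s"
  shows "Vector_Spaces.linear (K1_scale s) (*) K1_counit"
  using vector_space_K1_scale[OF assms] vector_space_field
  by (auto simp: Vector_Spaces.linear_iff K1_counit_def K1_scale_Pair[OF assms])

text \<open>
  Multilinearity in the summand \<open>V\<close>, in a shape that is safe for rewriting: the second component
  stays the literal \<open>0\<close>, so the vectors \<open>(x, 0)\<close> and \<^const>\<open>K1_e1\<close> act as normal forms.
\<close>
lemma bilinear_form_K1_simps:
  assumes "vector_space s" "bilinear_form (K1_scale s) \<beta>"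
  shows "\<beta> ((x + x', 0), w) = \<beta> ((x, 0), w) + \<beta> ((x', 0), w)"
    and "\<beta> (w, (x + x', 0)) = \<beta> (w, (x, 0)) + \<beta> (w, (x', 0))"
    and "\<beta> ((s c x, 0), w) = c * \<beta> ((x, 0), w)"
    and "\<beta> (w, (s c x, 0)) = c * \<beta> (w, (x, 0))"
    and "\<beta> ((0, 0), w) = 0"
    and "\<beta> (w, (0, 0)) = 0"
proof -
  interpret V: vector_space s by fact
  have \<beta>: "\<beta> (x + x', y) = \<beta> (x, y) + \<beta> (x', y)" "\<beta> (y, x + x') = \<beta> (y, x) + \<beta> (y, x')"
      "\<beta> (K1_scale s c x, y) = c * \<beta> (x, y)" "\<beta> (y, K1_scale s c x) = c * \<beta> (y, x)" for x x' y c
    using assms(2) unfolding bilinear_form_def by blast+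
  show "\<beta> ((x + x', 0), w) = \<beta> ((x, 0), w) + \<beta> ((x', 0), w)"
       "\<beta> (w, (x + x', 0)) = \<beta> (w, (x, 0)) + \<beta> (w, (x', 0))"
    using \<beta>(1)[of "(x, 0)" "(x', 0)"] \<beta>(2)[of w "(x, 0)" "(x', 0)"] by simp_all
  show "\<beta> ((s c x, 0), w) = c * \<beta> ((x, 0), w)" "\<beta> (w, (s c x, 0)) = c * \<beta> (w, (x, 0))"
    using \<beta>(3)[of c "(x, 0)"] \<beta>(4)[of _ c "(x, 0)"] by (simp_all add: K1_scale_Pair[OF assms(1)])
  show "\<beta> ((0, 0), w) = 0" "\<beta> (w, (0, 0)) = 0"
    using \<beta>(3)[of 0 "(0, 0)"] \<beta>(4)[of _ 0 "(0, 0)"]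
    by (simp_all add: K1_scale_Pair[OF assms(1)] V.scale_zero_right)
qed

text \<open>
  The decomposition of \<open>V \<oplus> K e\<^sub>1\<close>. As a rewrite rule this applies to its own right-hand side
  (with \<open>a = 0\<close>), so it is to be instantiated with specific \<open>x\<close> and \<open>a\<close>.
\<close>
lemma bilinear_form_K1_split:
  assumes "vector_space s" "bilinear_form (K1_scale s) \<beta>"
  shows "\<beta> ((x, a), w) = \<beta> ((x, 0), w) + a * \<beta> (K1_e1, w)"
    and "\<beta> (w, (x, a)) = \<beta> (w, (x, 0)) + a * \<beta> (w, K1_e1)"
proof -
  interpret V: vector_space s by fact
  have "(x, a) = (x, 0) + K1_scale s a K1_e1"
    using assms(1) by (simp add: K1_e1_def K1_scale_Pair V.scale_zero_right)
  then show "\<beta> ((x, a), w) = \<beta> ((x, 0), w) + a * \<beta> (K1_e1, w)"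
    and "\<beta> (w, (x, a)) = \<beta> (w, (x, 0)) + a * \<beta> (w, K1_e1)"
    using assms(2) unfolding bilinear_form_def by metis+
qed

lemma trilinear_form_K1_zero:
  assumes "vector_space s" "trilinear_form (K1_scale s) \<gamma>"
  shows "\<gamma> ((0, 0), v, w) = 0" "\<gamma> (v, (0, 0), w) = 0" "\<gamma> (v, w, (0, 0)) = 0"
proof -
  interpret V: vector_space s by fact
  have "bilinear_form (K1_scale s) (\<lambda>(x, y). \<gamma> (x, y, w))"
    and scale: "\<gamma> (v, w, K1_scale s 0 (0, 0)) = 0 * \<gamma> (v, w, (0, 0))"
    using assms(2) unfolding trilinear_form_def by blast+
  then show "\<gamma> ((0, 0), v, w) = 0" "\<gamma> (v, (0, 0), w) = 0"
    using bilinear_form_K1_simps(5,6)[OF assms(1)] by fastforce+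
  show "\<gamma> (v, w, (0, 0)) = 0"
    using scale by (simp add: K1_scale_Pair[OF assms(1)] V.scale_zero_right)
qed

section \<open>The coalgebra\<close>

text \<open>
  All maps on tensors in the axioms are linear extensions, into the scalars, a free vector space or
  \<open>V \<oplus> K e\<^sub>1\<close>; this evaluates them on a coproduct, for all three targets at once.
\<close>
lemma (in vector_space) lin_ext_K1_comult:
  "lin_ext scale f (K1_comult \<eta> \<alpha> (x, a)) =
     scale a (f (K1_e1, K1_e1)) +
     (f ((\<alpha> x, 0), K1_e1) + f (K1_e1, (\<alpha> x, 0)) - f ((\<eta> 1, 0), (\<alpha> x, 0)))"
  by (simp add: K1_comult_def lin_ext_simps)

lemmas ext_scalar = vector_space.lin_ext_simps[OF vector_space_field]
  vector_space.lin_ext_K1_comult[OF vector_space_field]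

lemmas ext_free = vector_space.lin_ext_simps[OF vector_space_fscale]
  vector_space.lin_ext_K1_comult[OF vector_space_fscale]

lemma K1_twist_simps: "K1_twist \<alpha> (x, a) = (\<alpha> x, a)" "\<alpha> 0 = 0 \<Longrightarrow> K1_twist \<alpha> K1_e1 = K1_e1"
  by (simp_all add: K1_twist_def K1_e1_def)

lemma K1_counit_simps: "K1_counit (x, a) = a" "K1_counit K1_e1 = 1"
  by (simp_all add: K1_counit_def K1_e1_def)

text \<open>
  For coassociativity, write \<open>x\<close> for \<open>\<alpha>\<^sup>2 x\<close>: both sides are
  \<open>x \<otimes> e\<^sub>1 \<otimes> e\<^sub>1 + e\<^sub>1 \<otimes> x \<otimes> e\<^sub>1 + e\<^sub>1 \<otimes> e\<^sub>1 \<otimes> x - e\<^sub>1 \<otimes> e\<^sub>2 \<otimes> x - e\<^sub>2 \<otimes> x \<otimes> e\<^sub>1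
  - e\<^sub>2 \<otimes> e\<^sub>1 \<otimes> x + e\<^sub>2 \<otimes> e\<^sub>2 \<otimes> x\<close>, where \<open>\<alpha> e\<^sub>2 = e\<^sub>2\<close> is what makes the terms with \<open>e\<^sub>2\<close>
  agree. The counit kills \<open>V\<close>, so of \<open>\<Delta>\<^sub>1 x\<close> it leaves exactly one term on each side.
\<close>
lemma counital_coalgebra_K1:
  assumes "Vector_Spaces.linear s s \<alpha>" and unit: "\<alpha> (\<eta> 1) = \<eta> 1"
  shows "counital_hom_coassociative_coalgebra (K1_scale s) (K1_comult \<eta> \<alpha>) K1_counit (K1_twist \<alpha>)"
proof -
  interpret \<alpha>: Vector_Spaces.linear s s \<alpha> by fact
  note V = \<alpha>.vs1.vector_space_axioms
  interpret K1: vector_space "K1_scale s" by (rule vector_space_K1_scale[OF V])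
  note twist = K1_twist_simps(1) K1_twist_simps(2)[of \<alpha>, OF \<alpha>.zero]
  let ?\<Delta> = "K1_comult \<eta> \<alpha>"
  \<comment> \<open>The evaluation rule for the coproduct expects a pair; \<^const>\<open>K1_e1\<close> is otherwise kept folded.\<close>
  have comult_e1: "lin_ext fscale f (?\<Delta> K1_e1) = lin_ext fscale f (?\<Delta> (0, 1))" for f
    by (simp add: K1_e1_def)
  show ?thesis
  \<comment> \<open>The locale predicates are unfolded only down to the linearity statements, which are already
      available as facts.\<close>
  proof (intro counital_hom_coassociative_coalgebra.intro
      counital_hom_coassociative_coalgebra_axioms.intro hom_coassociative_coalgebra.intro
      hom_coassociative_coalgebra_axioms.intro)
    show "vector_space (K1_scale s)"
      by (rule K1.vector_space_axioms)
    show "Vector_Spaces.linear (K1_scale s) (K1_scale s) (K1_twist \<alpha>)"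
      by (rule linear_K1_twist) fact
    show "Vector_Spaces.linear (K1_scale s) (*) K1_counit"
      by (rule linear_K1_counit[OF V])
    show "tensor2_eq (K1_scale s) (?\<Delta> (x + y)) (?\<Delta> x + ?\<Delta> y)" for x y
    proof (rule tensor2_eqI)
      fix \<beta> assume \<beta>: "bilinear_form (K1_scale s) \<beta>"
      show "lin_ext (*) \<beta> (?\<Delta> (x + y)) = lin_ext (*) \<beta> (?\<Delta> x + ?\<Delta> y)"
        by (cases x; cases y)
          (simp add: ext_scalar \<alpha>.add bilinear_form_K1_simps[OF V \<beta>] algebra_simps)
    qed
    show "tensor2_eq (K1_scale s) (?\<Delta> (K1_scale s c x)) (fscale c (?\<Delta> x))" for c x
    proof (rule tensor2_eqI)
      fix \<beta> assume \<beta>: "bilinear_form (K1_scale s) \<beta>"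
      show "lin_ext (*) \<beta> (?\<Delta> (K1_scale s c x)) = lin_ext (*) \<beta> (fscale c (?\<Delta> x))"
        by (cases x)
          (simp add: ext_scalar K1_scale_Pair[OF V] \<alpha>.scale bilinear_form_K1_simps[OF V \<beta>]
            algebra_simps)
    qed
    show "tensor2_eq (K1_scale s) (tensor_map (K1_twist \<alpha>) (K1_twist \<alpha>) (?\<Delta> x))
        (?\<Delta> (K1_twist \<alpha> x))" for x
      by (rule tensor2_eqI, cases x) (simp add: tensor_map_def ext_scalar ext_free twist unit)
    show "tensor3_eq (K1_scale s) (map_tensor_comult (K1_twist \<alpha>) ?\<Delta> (?\<Delta> x))
        (comult_tensor_map ?\<Delta> (K1_twist \<alpha>) (?\<Delta> x))" for x
    proof (rule tensor3_eqI)
      fix \<gamma> assume "trilinear_form (K1_scale s) \<gamma>"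
      note zero = trilinear_form_K1_zero[OF V this]
      show "lin_ext (*) \<gamma> (map_tensor_comult (K1_twist \<alpha>) ?\<Delta> (?\<Delta> x)) =
          lin_ext (*) \<gamma> (comult_tensor_map ?\<Delta> (K1_twist \<alpha>) (?\<Delta> x))"
        by (cases x)
          (simp add: map_tensor_comult_def comult_tensor_map_def ext_scalar ext_free comult_e1
            twist unit zero \<alpha>.zero algebra_simps)
    qed
    show "form_tensor_map (K1_scale s) K1_counit (K1_twist \<alpha>) (?\<Delta> x) = K1_twist \<alpha> (K1_twist \<alpha> x)"
      and "map_tensor_form (K1_scale s) (K1_twist \<alpha>) K1_counit (?\<Delta> x) = K1_twist \<alpha> (K1_twist \<alpha> x)"
      for x
      by (cases x; simp add: form_tensor_map_def map_tensor_form_def K1.lin_ext_K1_comult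
          twist K1_counit_simps; simp add: K1_e1_def K1_scale_Pair[OF V])+
  qed
qed

section \<open>The products\<close>

context unital_hom_associative_algebra
begin

sublocale mult_left: Vector_Spaces.linear scale scale "\<lambda>x. \<mu> x y" for y
  by (rule mult_linear_left)

sublocale mult_right: Vector_Spaces.linear scale scale "\<mu> x" for x
  by (rule mult_linear_right)

lemma unit_simps: "\<mu> x (\<eta> 1) = x" "\<mu> (\<eta> 1) x = x"
  using unital by auto

text \<open>This is what reduces the hom-associative case to the associative one.\<close>
lemma twist_eq_id:
  assumes "\<alpha> (\<eta> 1) = \<eta> 1"
  shows "\<alpha> x = x"
  using hom_assoc[of x "\<eta> 1" "\<eta> 1"] assms by (simp add: unit_simps)

lemma K1_twist_eq_id:
  assumes "\<alpha> (\<eta> 1) = \<eta> 1"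
  shows "K1_twist \<alpha> w = w"
  by (cases w) (simp add: K1_twist_def twist_eq_id[OF assms])

lemma K1_mult_simps:
  "K1_mult scale \<mu> (x, a) (y, b) = (\<mu> x y + scale b x + scale a y, a * b)"
  "K1_mult scale \<mu> K1_e1 w = w"
  "K1_mult scale \<mu> w K1_e1 = w"
  by (cases w; simp add: K1_mult_def K1_e1_def mult_left.zero mult_right.zero)+

text \<open>
  Since \<open>\<alpha>\<close> is the identity, this is the classical fact that adjoining a unit to an associative
  algebra gives an associative algebra.
\<close>
lemma unital_algebra_K1:
  assumes unit: "\<alpha> (\<eta> 1) = \<eta> 1"
  shows "unital_hom_associative_algebra (K1_scale scale) (K1_mult scale \<mu>) (K1_unit scale) (K1_twist \<alpha>)"
proof -
  note V = vector_space_axioms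
  interpret K1: vector_space "K1_scale scale" by (rule vector_space_K1_scale[OF V])
  have assoc: "\<mu> x (\<mu> y z) = \<mu> (\<mu> x y) z" for x y z
    using hom_assoc[of x y z] by (simp add: twist_eq_id[OF unit])
  note bilinear = mult_left.add mult_right.add mult_left.scale mult_right.scale
    scale_right_distrib scale_left_distrib
  show ?thesis
  proof (intro unital_hom_associative_algebra.intro unital_hom_associative_algebra_axioms.intro
      hom_associative_algebra.intro hom_associative_algebra_axioms.intro)
    show "vector_space (K1_scale scale)"
      by (rule K1.vector_space_axioms)
    show "Vector_Spaces.linear (K1_scale scale) (K1_scale scale) (K1_twist \<alpha>)"
      by (rule linear_K1_twist[OF twist_linear])
    show "Vector_Spaces.linear (K1_scale scale) (K1_scale scale) (\<lambda>v. K1_mult scale \<mu> v w)"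
      and "Vector_Spaces.linear (K1_scale scale) (K1_scale scale) (K1_mult scale \<mu> w)" for w
      using K1.vector_space_axioms
      by (cases w; auto simp: Vector_Spaces.linear_iff K1_mult_simps K1_scale_Pair[OF V] bilinear
          algebra_simps)+
    show "K1_twist \<alpha> (K1_mult scale \<mu> v w) = K1_mult scale \<mu> (K1_twist \<alpha> v) (K1_twist \<alpha> w)" for v w
      by (simp add: K1_twist_eq_id[OF unit])
    show "K1_mult scale \<mu> (K1_twist \<alpha> u) (K1_mult scale \<mu> v w) =
        K1_mult scale \<mu> (K1_mult scale \<mu> u v) (K1_twist \<alpha> w)" for u v w
      by (cases u; cases v; cases w)
        (simp add: K1_twist_eq_id[OF unit] K1_mult_simps assoc bilinear algebra_simps)
    show "\<exists>e. (\<forall>w. K1_mult scale \<mu> w e = w \<and> K1_mult scale \<mu> e w = w) \<and>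
        (\<forall>c. K1_unit scale c = K1_scale scale c e)"
      by (rule exI[of _ K1_e1]) (simp add: K1_mult_simps K1_unit_def)
  qed
qed

text \<open>
  For \<open>x\<close>, \<open>y\<close> in \<open>V\<close> use that \<open>e\<^sub>1 - e\<^sub>2\<close> is an idempotent that annihilates \<open>V\<close> on both sides.
  Hence \<open>(x \<otimes> e\<^sub>1 + (e\<^sub>1 - e\<^sub>2) \<otimes> x) (y \<otimes> e\<^sub>1 + (e\<^sub>1 - e\<^sub>2) \<otimes> y)\<close> has no
  mixed terms and equals \<open>x y \<otimes> e\<^sub>1 + (e\<^sub>1 - e\<^sub>2) \<otimes> x y\<close>.
\<close>
lemma K1_comult_mult:
  assumes unit: "\<alpha> (\<eta> 1) = \<eta> 1"
  shows "tensor2_eq (K1_scale scale) (K1_comult \<eta> \<alpha> (K1_mult scale \<mu> v w))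
    (tensor_mult (K1_mult scale \<mu>) (K1_comult \<eta> \<alpha> v) (K1_comult \<eta> \<alpha> w))"
proof (rule tensor2_eqI)
  note V = vector_space_axioms
  fix \<beta> assume \<beta>: "bilinear_form (K1_scale scale) \<beta>"
  show "lin_ext (*) \<beta> (K1_comult \<eta> \<alpha> (K1_mult scale \<mu> v w)) =
      lin_ext (*) \<beta> (tensor_mult (K1_mult scale \<mu>) (K1_comult \<eta> \<alpha> v) (K1_comult \<eta> \<alpha> w))"
    by (cases v; cases w)
      (simp add: tensor_mult_def ext_scalar ext_free K1_mult_simps twist_eq_id[OF unit] unit_simps
        bilinear_form_K1_simps[OF V \<beta>] algebra_simps)
qed

text \<open>
  For \<open>x\<close>, \<open>y\<close> in \<open>V\<close>, the first summand is \<open>x y \<otimes> e\<^sub>1 + x (e\<^sub>1 - e\<^sub>2) \<otimes> y = x y \<otimes> e\<^sub>1\<close>, the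
  second is \<open>x \<otimes> y + (e\<^sub>1 - e\<^sub>2) \<otimes> x y\<close>, and the subtracted \<open>x \<otimes> y\<close> removes the mixed term.
  If one argument is \<open>e\<^sub>1\<close>, then one summand is the coproduct of the other argument and the
  remaining two terms cancel.
\<close>
lemma K1_infinitesimal:
  assumes unit: "\<alpha> (\<eta> 1) = \<eta> 1"
  shows "tensor2_eq (K1_scale scale) (K1_comult \<eta> \<alpha> (K1_mult scale \<mu> v w))
    (mult_tensor_map (K1_mult scale \<mu>) (K1_twist \<alpha>)
       (map_tensor_comult (K1_twist \<alpha>) (K1_comult \<eta> \<alpha>) (pure2 v w)) +
     map_tensor_mult (K1_twist \<alpha>) (K1_mult scale \<mu>)
       (comult_tensor_map (K1_comult \<eta> \<alpha>) (K1_twist \<alpha>) (pure2 v w)) -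
     tensor_map (K1_twist \<alpha> \<circ> K1_twist \<alpha>) (K1_twist \<alpha>) (pure2 v w))"
    (is "tensor2_eq _ ?lhs ?rhs")
proof (rule tensor2_eqI)
  note V = vector_space_axioms
  fix \<beta> assume \<beta>: "bilinear_form (K1_scale scale) \<beta>"
  obtain x a y b where vw: "v = (x, a)" "w = (y, b)" by fastforce
  show "lin_ext (*) \<beta> ?lhs = lin_ext (*) \<beta> ?rhs"
    unfolding vw
    by (simp add: mult_tensor_map_def map_tensor_mult_def map_tensor_comult_def
        comult_tensor_map_def tensor_map_def ext_scalar ext_free K1_mult_simps
        K1_twist_eq_id[OF unit] twist_eq_id[OF unit] unit_simps
        bilinear_form_K1_split[OF V \<beta>, where x = x and a = a]
        bilinear_form_K1_split[OF V \<beta>, where x = y and a = b]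
        bilinear_form_K1_simps[OF V \<beta>] algebra_simps)
qed

end

theorem proposition3p6:
  fixes scale :: "'k::field \<Rightarrow> 'v::ab_group_add \<Rightarrow> 'v"
    and \<mu> \<mu>' :: "'v \<Rightarrow> 'v \<Rightarrow> 'v"
    and \<eta> :: "'k \<Rightarrow> 'v" and \<alpha> :: "'v \<Rightarrow> 'v" and n :: nat
  assumes "has_dimension scale n"
    and "unital_hom_associative_algebra scale \<mu> \<eta> \<alpha>"
    and "unital_hom_associative_algebra scale \<mu>' \<eta> \<alpha>"
    and "\<alpha> (\<eta> 1) = \<eta> 1"
  shows "unital_2_hom_associative_bialgebra (K1_scale scale)
           (K1_mult scale \<mu>) (K1_mult scale \<mu>') (K1_unit scale)
           (K1_comult \<eta> \<alpha>) K1_counit (K1_twist \<alpha>)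
         \<and> has_dimension (K1_scale scale) (n + 1)"
proof
  interpret A: unital_hom_associative_algebra scale \<mu> \<eta> \<alpha> by fact
  interpret A': unital_hom_associative_algebra scale \<mu>' \<eta> \<alpha> by fact
  interpret K: unital_hom_associative_algebra "K1_scale scale" "K1_mult scale \<mu>" "K1_unit scale"
      "K1_twist \<alpha>"
    by (rule A.unital_algebra_K1) fact
  interpret K': unital_hom_associative_algebra "K1_scale scale" "K1_mult scale \<mu>'" "K1_unit scale"
      "K1_twist \<alpha>"
    by (rule A'.unital_algebra_K1) fact
  interpret C: counital_hom_coassociative_coalgebra "K1_scale scale" "K1_comult \<eta> \<alpha>" K1_counit
      "K1_twist \<alpha>"
    by (rule counital_coalgebra_K1[OF A.twist_linear]) fact
  show "unital_2_hom_associative_bialgebra (K1_scale scale)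
      (K1_mult scale \<mu>) (K1_mult scale \<mu>') (K1_unit scale)
      (K1_comult \<eta> \<alpha>) K1_counit (K1_twist \<alpha>)"
  proof
    fix v w :: "'v \<times> 'k"
    show "tensor2_eq (K1_scale scale) (K1_comult \<eta> \<alpha> (K1_mult scale \<mu> v w))
        (tensor_mult (K1_mult scale \<mu>) (K1_comult \<eta> \<alpha> v) (K1_comult \<eta> \<alpha> w))"
      by (rule A.K1_comult_mult) fact
    show "K1_counit (K1_mult scale \<mu> v w) = K1_counit v * K1_counit w"
      by (cases v; cases w) (simp add: K1_counit_simps A.K1_mult_simps)
    show "K1_counit (K1_twist \<alpha> v) = K1_counit v"
      by (cases v) (simp add: K1_counit_simps K1_twist_simps)
  qed (rule A'.K1_infinitesimal, fact)
  show "has_dimension (K1_scale scale) (n + 1)"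
    by (rule has_dimension_K1_scale) fact
qed

end
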